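(* Let $i\in\{1,\dots,M\}$ and $l\in\{1,\dots,r_i\}$, and let $c_j\in\mathbb{R}^{n_j}$ and $\alpha_j\ge0$ for $j\in\{1,\dots,M\}$. Denote by $H^l_i$ the $l$-th row of $H_i$ and by $h^l_i$ the $l$-th element of $h_i$. Suppose there exist scalars $\rho^l_{ij}\ge0$, $j\in\mathcal{N}_i$, such that the symmetric block matrix $$ \begin{bmatrix} h_i^l & H_i^lK_{\mathcal{N}_i}\alpha_{\mathcal{N}_i}^{1/2} & H_i^lK_{\mathcal{N}_i}c_{\mathcal{N}_i}\\ \alpha_{\mathcal{N}_i}^{1/2}K_{\mathcal{N}_i}^\top(H_i^l)^\top & \sum_{j\in\mathcal{N}_i}\rho_{ij}^lP_{ij} & 0\\ c_{\mathcal{N}_i}^\top K_{\mathcal{N}_i}^\top(H_i^l)^\top & 0 & h_i^l-\sum_{j\in\mathcal{N}_i}\rho_{ij}^l \end{bmatrix} $$ is positive semidefinite. Then the $l$-th input constraint $H^l_iK_{\mathcal{N}_i}x_{\mathcal{N}_i}\le h^l_i$ holds for every $x_{\mathcal{N}_i}\in\mathbb{R}^{n_{N_i}}$ whose components $x_j$, $j\in\mathcal{N}_i$, satisfy $(x_j-c_j)^\top P_j(x_j-c_j)\le\alpha_j$ for all $j\in\mathcal{N}_i$.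
   Context: A system is composed of $M$ subsystems; subsystem $j$ has state $x_j\in\mathbb{R}^{n_j}$ and input $u_j\in\mathbb{R}^{m_j}$. The global state is $x=[x_1^\top,\dots,x_M^\top]^\top\in\mathbb{R}^n$. For each $i$, $\mathcal{N}_i\subseteq\{1,\dots,M\}$ is the set of neighbors of subsystem $i$, with $i\in\mathcal{N}_i$, and $x_{\mathcal{N}_i}\in\mathbb{R}^{n_{N_i}}$ is the concatenation of the $x_j$, $j\in\mathcal{N}_i$ (so $n_{N_i}=\sum_{j\in\mathcal{N}_i}n_j$). $U_j\in\{0,1\}^{n_j\times n}$ and $W_{\mathcal{N}_i}\in\{0,1\}^{n_{N_i}\times n}$ are the selection matrices with $x_j=U_jx$ and $x_{\mathcal{N}_i}=W_{\mathcal{N}_i}x$. A terminal controller $u_i=K_{\mathcal{N}_i}x_{\mathcal{N}_i}$ with gain $K_{\mathcal{N}_i}\in\mathbb{R}^{m_i\times n_{N_i}}$ and symmetric positive definite matrices $P_j\in\mathbb{R}^{n_j\times n_j}$ are given; the terminal set of subsystem $j$ is the ellipsoid $\{x_j:(x_j-c_j)^\top P_j(x_j-c_j)\le\alpha_j\}$ with center $c_j$ and size $\alpha_j$. The input constraint set of subsystem $i$ is $\{u_i\in\mathbb{R}^{m_i}:H_iu_i\le h_i\}$ (componentwise inequality) with $H_i\in\mathbb{R}^{r_i\times m_i}$, $h_i\in\mathbb{R}^{r_i}$; it is assumed to contain the origin in its interior. Notation: $\alpha=\operatorname{diag}(\alpha_1I_{n_1},\dots,\alpha_MI_{n_M})$,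 $c=[c_1^\top,\dots,c_M^\top]^\top$, $\alpha_{\mathcal{N}_i}=W_{\mathcal{N}_i}\alpha W_{\mathcal{N}_i}^\top$ (diagonal, with entrywise square root $\alpha_{\mathcal{N}_i}^{1/2}$ on the diagonal), $c_{\mathcal{N}_i}=W_{\mathcal{N}_i}c$. For $j\in\mathcal{N}_i$, $P_{ij}=W_{\mathcal{N}_i}U_j^\top P_jU_jW_{\mathcal{N}_i}^\top$, i.e. the block-diagonal matrix with block $P_j$ at the position of $x_j$ in $x_{\mathcal{N}_i}$ and zeros elsewhere, so that $s_{\mathcal{N}_i}^\top P_{ij}s_{\mathcal{N}_i}=s_j^\top P_js_j$. *)

theory Defs
  imports Complex_Main "Jordan_Normal_Form.Matrix"
begin

text \<open>
  Subsystems are numbered \<open>0, \<dots>, M - 1\<close>, following the zero-based indexing of vectors and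
  matrices in \<open>Jordan_Normal_Form\<close>. The state of subsystem \<open>j\<close> has dimension \<open>n j\<close>.
\<close>

definition pos_semidef :: "nat \<Rightarrow> real mat \<Rightarrow> bool" where
  "pos_semidef k A \<longleftrightarrow> A \<in> carrier_mat k k \<and> A\<^sup>T = A \<and>
     (\<forall>v \<in> carrier_vec k. 0 \<le> v \<bullet> (A *\<^sub>v v))"

definition pos_def :: "nat \<Rightarrow> real mat \<Rightarrow> bool" where
  "pos_def k A \<longleftrightarrow> A \<in> carrier_mat k k \<and> A\<^sup>T = A \<and>
     (\<forall>v \<in> carrier_vec k. v \<noteq> 0\<^sub>v k \<longrightarrow> 0 < v \<bullet> (A *\<^sub>v v))"

definition stack :: "nat set \<Rightarrow> (nat \<Rightarrow> real vec) \<Rightarrow> real vec" where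
  "stack J x = vec_of_list (concat (map (\<lambda>j. list_of_vec (x j)) (sorted_list_of_set J)))"

definition sel_U :: "nat \<Rightarrow> (nat \<Rightarrow> nat) \<Rightarrow> nat \<Rightarrow> real mat" where
  "sel_U M n j = mat (n j) (\<Sum>k<M. n k) (\<lambda>(a, b). if b = (\<Sum>k<j. n k) + a then 1 else 0)"

definition sel_W :: "nat \<Rightarrow> (nat \<Rightarrow> nat) \<Rightarrow> nat set \<Rightarrow> real mat" where
  "sel_W M n J =
     mat_of_rows (\<Sum>k<M. n k) (concat (map (\<lambda>j. rows (sel_U M n j)) (sorted_list_of_set J)))"

definition nbr_center :: "nat \<Rightarrow> (nat \<Rightarrow> nat) \<Rightarrow> nat set \<Rightarrow> (nat \<Rightarrow> real vec) \<Rightarrow> real vec" where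
  "nbr_center M n J c = sel_W M n J *\<^sub>v stack {..<M} c"

definition nbr_alpha :: "nat \<Rightarrow> (nat \<Rightarrow> nat) \<Rightarrow> nat set \<Rightarrow> (nat \<Rightarrow> real) \<Rightarrow> real mat" where
  "nbr_alpha M n J \<alpha> =
     sel_W M n J * diag_block_mat (map (\<lambda>j. \<alpha> j \<cdot>\<^sub>m 1\<^sub>m (n j)) [0..<M]) * (sel_W M n J)\<^sup>T"

text \<open>The entrywise root is the matrix root here, since \<open>nbr_alpha\<close> is diagonal.\<close>

definition nbr_alpha_sqrt :: "nat \<Rightarrow> (nat \<Rightarrow> nat) \<Rightarrow> nat set \<Rightarrow> (nat \<Rightarrow> real) \<Rightarrow> real mat" where
  "nbr_alpha_sqrt M n J \<alpha> = map_mat sqrt (nbr_alpha M n J \<alpha>)"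

definition nbr_P ::
  "nat \<Rightarrow> (nat \<Rightarrow> nat) \<Rightarrow> nat set \<Rightarrow> (nat \<Rightarrow> real mat) \<Rightarrow> nat \<Rightarrow> real mat" where
  "nbr_P M n J P j =
     sel_W M n J * (sel_U M n j)\<^sup>T * P j * sel_U M n j * (sel_W M n J)\<^sup>T"

text \<open>The type of matrices is not a monoid under addition, so the sum is taken entrywise.\<close>

definition nbr_P_sum ::
  "nat \<Rightarrow> (nat \<Rightarrow> nat) \<Rightarrow> nat set \<Rightarrow> (nat \<Rightarrow> real mat) \<Rightarrow> (nat \<Rightarrow> real) \<Rightarrow> real mat" where
  "nbr_P_sum M n J P \<rho> =
     mat (\<Sum>j\<in>J. n j) (\<Sum>j\<in>J. n j) (\<lambda>ab. \<Sum>j\<in>J. (\<rho> j \<cdot>\<^sub>m nbr_P M n J P j) $$ ab)"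

definition terminal_set :: "nat \<Rightarrow> real mat \<Rightarrow> real vec \<Rightarrow> real \<Rightarrow> real vec set" where
  "terminal_set k P c \<alpha> = {x \<in> carrier_vec k. (x - c) \<bullet> (P *\<^sub>v (x - c)) \<le> \<alpha>}"

definition input_set :: "nat \<Rightarrow> real mat \<Rightarrow> real vec \<Rightarrow> real vec set" where
  "input_set k H h = {u \<in> carrier_vec k. H *\<^sub>v u \<le> h}"

text \<open>
  There is no topology on the type of vectors of arbitrary dimension; the Euclidean one on the
  vectors of dimension \<open>k\<close> is spelled out with open balls.
\<close>

definition origin_in_interior :: "nat \<Rightarrow> real vec set \<Rightarrow> bool" where
  "origin_in_interior k S \<longleftrightarrow> (\<exists>\<epsilon>>0. {u \<in> carrier_vec k. sqrt (u \<bullet> u) < \<epsilon>} \<subseteq> S)"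

definition scalar_mat :: "real \<Rightarrow> real mat" where
  "scalar_mat a = mat 1 1 (\<lambda>_. a)"

definition col_mat :: "real vec \<Rightarrow> real mat" where
  "col_mat v = mat_of_cols (dim_vec v) [v]"

text \<open>Blocks are listed row by row.\<close>

definition block3_mat ::
  "real mat \<Rightarrow> real mat \<Rightarrow> real mat \<Rightarrow> real mat \<Rightarrow> real mat \<Rightarrow> real mat \<Rightarrow>
   real mat \<Rightarrow> real mat \<Rightarrow> real mat \<Rightarrow> real mat" where
  "block3_mat A11 A12 A13 A21 A22 A23 A31 A32 A33 =
     four_block_mat (four_block_mat A11 A12 A21 A22)
       (four_block_mat A13 (0\<^sub>m (dim_row A13) 0) A23 (0\<^sub>m (dim_row A23) 0))
       (four_block_mat A31 A32 (0\<^sub>m 0 (dim_col A31)) (0\<^sub>m 0 (dim_col A32)))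
       A33"

text \<open>
  The linear matrix inequality is stated for a row \<open>Hl\<close> (as a \<open>1 \<times> m\<close> matrix) and the
  corresponding bound \<open>hl\<close>; \<open>J\<close> is the neighbor set.
\<close>

definition input_lmi_mat ::
  "nat \<Rightarrow> (nat \<Rightarrow> nat) \<Rightarrow> nat set \<Rightarrow> real mat \<Rightarrow> (nat \<Rightarrow> real mat) \<Rightarrow> (nat \<Rightarrow> real vec) \<Rightarrow>
   (nat \<Rightarrow> real) \<Rightarrow> real mat \<Rightarrow> real \<Rightarrow> (nat \<Rightarrow> real) \<Rightarrow> real mat" where
  "input_lmi_mat M n J K P c \<alpha> Hl hl \<rho> =
    (let nN = (\<Sum>j\<in>J. n j);
         aN = nbr_alpha_sqrt M n J \<alpha>;
         cN = col_mat (nbr_center M n J c)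
     in block3_mat
          (scalar_mat hl)      (Hl * K * aN)            (Hl * K * cN)
          (aN * K\<^sup>T * Hl\<^sup>T)     (nbr_P_sum M n J P \<rho>)    (0\<^sub>m nN 1)
          (cN\<^sup>T * K\<^sup>T * Hl\<^sup>T)    (0\<^sub>m 1 nN)               (scalar_mat (hl - (\<Sum>j\<in>J. \<rho> j))))"

text \<open>The selection matrices act as intended.\<close>

lemma dim_stack:
  assumes "finite J" "\<And>j. j \<in> J \<Longrightarrow> x j \<in> carrier_vec (n j)"
  shows "dim_vec (stack J x) = (\<Sum>j\<in>J. n j)"
proof -
  have "dim_vec (stack J x) = sum_list (map (\<lambda>j. dim_vec (x j)) (sorted_list_of_set J))"
    by (simp add: stack_def length_concat comp_def)
  also have "\<dots> = (\<Sum>j\<in>J. dim_vec (x j))"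
    using assms(1) by (simp add: sum_list_distinct_conv_sum_set)
  also have "\<dots> = (\<Sum>j\<in>J. n j)"
    using assms(2) by (intro sum.cong) auto
  finally show ?thesis .
qed

lemma stack_index:
  assumes "\<And>j. j < M \<Longrightarrow> x j \<in> carrier_vec (n j)" "j < M" "a < n j"
  shows "stack {..<M} x $ ((\<Sum>k<j. n k) + a) = x j $ a"
  using assms
proof (induction M)
  case (Suc M)
  have s: "sorted_list_of_set {..<Suc M} = sorted_list_of_set {..<M} @ [M]"
    by (simp flip: atLeast0LessThan)
  have app: "stack {..<Suc M} x = stack {..<M} x @\<^sub>v x M"
    by (intro eq_vecI)
      (auto simp: stack_def s vec_of_list_index nth_append list_of_vec_index
        simp del: lessThan_Suc simp flip: length_concat)
  have d: "dim_vec (stack {..<M} x) = (\<Sum>k<M. n k)"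
    using Suc.prems(1) by (intro dim_stack) auto
  have dM: "dim_vec (x M) = n M"
    using Suc.prems(1) by auto
  show ?case
  proof (cases "j < M")
    case True
    have "(\<Sum>k<j. n k) + a < (\<Sum>k<Suc j. n k)"
      using Suc.prems(3) by simp
    also have "\<dots> \<le> (\<Sum>k<M. n k)"
      using True by (intro sum_mono2) auto
    finally show ?thesis
      using Suc.IH Suc.prems True by (simp add: app d dM)
  next
    case False
    then have "j = M" using Suc.prems(2) by simp
    then show ?thesis
      using Suc.prems(3) by (simp add: app d dM)
  qed
qed simp

lemma sel_U_stack:
  assumes "\<And>j. j < M \<Longrightarrow> x j \<in> carrier_vec (n j)" "j < M"
  shows "sel_U M n j *\<^sub>v stack {..<M} x = x j"
proof (rule eq_vecI)
  have d: "dim_vec (stack {..<M} x) = (\<Sum>k<M. n k)"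
    using assms(1) by (intro dim_stack) auto
  fix a assume "a < dim_vec (x j)"
  then have a: "a < n j" using carrier_vecD[OF assms(1)[OF assms(2)]] by simp
  have "(\<Sum>k<j. n k) + a < (\<Sum>k<Suc j. n k)"
    using a by simp
  also have "\<dots> \<le> (\<Sum>k<M. n k)"
    using assms(2) by (intro sum_mono2) auto
  finally have lt: "(\<Sum>k<j. n k) + a < (\<Sum>k<M. n k)" .
  have "(sel_U M n j *\<^sub>v stack {..<M} x) $ a =
      (\<Sum>b<(\<Sum>k<M. n k). (if b = (\<Sum>k<j. n k) + a then 1 else 0) * stack {..<M} x $ b)"
    using a by (auto simp: sel_U_def scalar_prod_def d atLeast0LessThan intro!: sum.cong)
  also have "\<dots> = stack {..<M} x $ ((\<Sum>k<j. n k) + a)"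
    using lt by (simp add: if_distrib[of "\<lambda>t. t * _"] cong: if_cong)
  finally show "(sel_U M n j *\<^sub>v stack {..<M} x) $ a = x j $ a"
    using stack_index[of M x n j a] assms a by simp
qed (use carrier_vecD[OF assms(1)[OF assms(2)]] in \<open>simp add: sel_U_def\<close>)

lemma sel_W_stack:
  assumes "\<And>j. j < M \<Longrightarrow> x j \<in> carrier_vec (n j)" "J \<subseteq> {..<M}"
  shows "sel_W M n J *\<^sub>v stack {..<M} x = stack J x"
proof -
  let ?X = "stack {..<M} x"
  have mv: "list_of_vec (A *\<^sub>v ?X) = map (\<lambda>v. v \<bullet> ?X) (rows A)" for A
    by (rule nth_equalityI) (auto simp: list_of_vec_index)
  have rU: "set (rows (sel_U M n j)) \<subseteq> carrier_vec (\<Sum>k<M. n k)" for j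
    using rows_carrier[of "sel_U M n j"] by (simp add: sel_U_def)
  have "rows (sel_W M n J) = concat (map (\<lambda>j. rows (sel_U M n j)) (sorted_list_of_set J))"
    unfolding sel_W_def using rU by (intro rows_mat_of_rows) fastforce
  then have "list_of_vec (sel_W M n J *\<^sub>v ?X) =
      concat (map (\<lambda>j. list_of_vec (sel_U M n j *\<^sub>v ?X)) (sorted_list_of_set J))"
    by (simp add: mv map_concat comp_def)
  also have "\<dots> = concat (map (\<lambda>j. list_of_vec (x j)) (sorted_list_of_set J))"
    using assms finite_subset[OF assms(2)]
    by (intro arg_cong[of _ _ concat] map_cong) (auto simp: sel_U_stack)
  finally show ?thesis
    unfolding stack_def by (metis vec_list)
qed

end

theory Submission
  imports Defs
begin

text \<open>
  Write \<open>x j = c j + sqrt (\<alpha> j) s j\<close> with \<open>s j \<bullet> P j s j \<le> 1\<close>, and let \<open>s\<close> be the stacked \<open>s j\<close>.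
  Evaluating the quadratic form of the matrix inequality at \<open>(-1, s, 1)\<close> makes the two
  off-diagonal blocks add up to \<open>- 2 H K x\<close>, so that \<open>2 h - 2 H K x\<close> is at least
  \<open>\<Sum>j. \<rho> j (1 - s j \<bullet> P j s j)\<close>, which is nonnegative.
\<close>

section \<open>Positions of the stacked coordinates in the global state\<close>

text \<open>The position in the global state of each coordinate of the stacked neighbor state.\<close>

definition nbr_pos :: "(nat \<Rightarrow> nat) \<Rightarrow> nat set \<Rightarrow> nat list" where
  "nbr_pos n J =
     concat (map (\<lambda>j. map (\<lambda>a. (\<Sum>k<j. n k) + a) [0..<n j]) (sorted_list_of_set J))"

lemma offset_less:
  fixes n :: "nat \<Rightarrow> nat"
  assumes "j < k" "a < n j"
  shows "(\<Sum>t<j. n t) + a < (\<Sum>t<k. n t)"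
proof -
  have "(\<Sum>t<j. n t) + a < (\<Sum>t<Suc j. n t)"
    using assms(2) by simp
  also have "\<dots> \<le> (\<Sum>t<k. n t)"
    using assms(1) by (intro sum_mono2) auto
  finally show ?thesis .
qed

text \<open>Subsystems occupy disjoint intervals of the global state: if \<open>j < k\<close>, then
  \<open>offset_less\<close> puts every position of \<open>j\<close> strictly below the offset of
  \<open>k\<close>, and symmetrically. It serves as a destruction rule in
  \<open>distinct_nbr_pos\<close>.\<close>

lemma offset_interval_unique:
  fixes n :: "nat \<Rightarrow> nat"
  assumes "(\<Sum>t<j. n t) \<le> p" "p < n j + (\<Sum>t<j. n t)"
    and "(\<Sum>t<k. n t) \<le> p" "p < n k + (\<Sum>t<k. n t)"
  shows "j = k"
proof -
  obtain a b where "p = (\<Sum>t<j. n t) + a" "p = (\<Sum>t<k. n t) + b"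
    using assms(1,3) le_Suc_ex by blast
  then show ?thesis
    using offset_less[of j k a n] offset_less[of k j b n] assms(2,4)
    by (cases j k rule: linorder_cases) auto
qed

lemma set_nbr_pos:
  assumes "finite J"
  shows "set (nbr_pos n J) = {(\<Sum>k<j. n k) + a | j a. j \<in> J \<and> a < n j}"
proof -
  have "set (nbr_pos n J) = (\<Union>j\<in>J. (\<lambda>a. (\<Sum>k<j. n k) + a) ` {..<n j})"
    using assms by (simp add: nbr_pos_def flip: atLeast0LessThan)
  then show ?thesis by auto
qed

lemma length_nbr_pos:
  assumes "finite J"
  shows "length (nbr_pos n J) = (\<Sum>j\<in>J. n j)"
  using assms by (simp add: nbr_pos_def length_concat comp_def sum_list_distinct_conv_sum_set)

lemma distinct_nbr_pos: "distinct (nbr_pos n J)"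
proof -
  \<comment> \<open>Generalised from the sorted neighbor list to any distinct list, so that
    induction on the list applies.\<close>
  have "distinct (concat (map (\<lambda>j. map (\<lambda>a. (\<Sum>k<j. n k) + a) [0..<n j]) js))"
    if "distinct js" for js
    using that by (induction js) (auto simp: distinct_map dest: offset_interval_unique)
  then show ?thesis
    by (simp add: nbr_pos_def)
qed

section \<open>The selection matrices as lists of unit rows\<close>

lemma rows_sel_U:
  assumes "j < M"
  shows "rows (sel_U M n j) =
    map (unit_vec (\<Sum>k<M. n k)) (map (\<lambda>a. (\<Sum>k<j. n k) + a) [0..<n j])"
proof (rule nth_equalityI)
  fix a assume "a < length (rows (sel_U M n j))"
  then have "a < n j" by (simp add: sel_U_def)
  then show "rows (sel_U M n j) ! a =
      map (unit_vec (\<Sum>k<M. n k)) (map (\<lambda>a. (\<Sum>k<j. n k) + a) [0..<n j]) ! a"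
    using offset_less[OF assms, of a n] by (intro eq_vecI) (auto simp: sel_U_def unit_vec_def)
qed (simp add: sel_U_def)

text \<open>This reduces later computations with \<open>sel_W\<close> to lookups in
  \<open>nbr_pos\<close>: the scalar product with a unit row reads off a single coordinate.\<close>

lemma rows_sel_W:
  assumes "J \<subseteq> {..<M}"
  shows "rows (sel_W M n J) = map (unit_vec (\<Sum>k<M. n k)) (nbr_pos n J)"
proof -
  have "finite J" using assms finite_subset by blast
  then have eq: "map (\<lambda>j. rows (sel_U M n j)) (sorted_list_of_set J) =
      map (\<lambda>j. map (unit_vec (\<Sum>k<M. n k)) (map (\<lambda>a. (\<Sum>k<j. n k) + a) [0..<n j]))
        (sorted_list_of_set J)"
    using assms by (intro map_cong refl rows_sel_U) auto
  have "concat (map (\<lambda>j. rows (sel_U M n j)) (sorted_list_of_set J)) =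
      map (unit_vec (\<Sum>k<M. n k)) (nbr_pos n J)"
    unfolding eq nbr_pos_def map_concat map_map comp_def ..
  then show ?thesis
    unfolding sel_W_def by (simp, intro rows_mat_of_rows) auto
qed

lemma sel_U_carrier [simp]: "sel_U M n j \<in> carrier_mat (n j) (\<Sum>k<M. n k)"
  by (simp add: sel_U_def)

lemma sel_W_carrier:
  assumes "J \<subseteq> {..<M}"
  shows "sel_W M n J \<in> carrier_mat (\<Sum>j\<in>J. n j) (\<Sum>k<M. n k)"
proof
  have "finite J" using assms finite_subset by blast
  then show "dim_row (sel_W M n J) = (\<Sum>j\<in>J. n j)"
    using arg_cong[OF rows_sel_W[OF assms, of n], of length] by (simp add: length_nbr_pos)
qed (simp add: sel_W_def)

lemma row_sel_W:
  assumes "J \<subseteq> {..<M}" "a < (\<Sum>j\<in>J. n j)"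
  shows "row (sel_W M n J) a = unit_vec (\<Sum>k<M. n k) (nbr_pos n J ! a)"
proof -
  have "finite J" using assms(1) finite_subset by blast
  then show ?thesis
    using nth_rows[of a "sel_W M n J"] sel_W_carrier[OF assms(1), of n] assms
    by (simp add: rows_sel_W length_nbr_pos)
qed

lemma nbr_pos_less:
  assumes "J \<subseteq> {..<M}" "a < (\<Sum>j\<in>J. n j)"
  shows "nbr_pos n J ! a < (\<Sum>k<M. n k)"
proof -
  have fin: "finite J" using assms(1) finite_subset by blast
  then have "nbr_pos n J ! a \<in> set (nbr_pos n J)"
    using assms(2) by (simp add: length_nbr_pos)
  then show ?thesis
    using assms(1) fin by (auto simp: set_nbr_pos intro!: offset_less)
qed

lemma sel_W_mult_vec_index:
  assumes "J \<subseteq> {..<M}" "a < (\<Sum>j\<in>J. n j)" "y \<in> carrier_vec (\<Sum>k<M. n k)"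
  shows "(sel_W M n J *\<^sub>v y) $ a = y $ (nbr_pos n J ! a)"
  using assms sel_W_carrier[OF assms(1), of n] nbr_pos_less[OF assms(1,2)]
  by (simp add: row_sel_W)

section \<open>Stacked vectors coordinate by coordinate, and recovery of a component\<close>

lemma stack_carrier:
  assumes "finite J" "\<And>j. j \<in> J \<Longrightarrow> x j \<in> carrier_vec (n j)"
  shows "stack J x \<in> carrier_vec (\<Sum>j\<in>J. n j)"
  using dim_stack[OF assms] by (rule carrier_vecI)

lemma stack_cong:
  assumes "finite J" "\<And>j. j \<in> J \<Longrightarrow> x j = y j"
  shows "stack J x = stack J y"
  unfolding stack_def using assms
  by (intro arg_cong[of _ _ vec_of_list] arg_cong[of _ _ concat] map_cong) auto

text \<open>Two readings of \<open>sel_W M n J *\<^sub>v stack {..<M} x\<close> are compared: by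
  \<open>sel_W_stack\<close> it is the neighbor stack, and by its unit rows it picks the positions
  in \<open>nbr_pos\<close>.\<close>

lemma stack_nbr_pos:
  assumes "\<And>j. j < M \<Longrightarrow> x j \<in> carrier_vec (n j)" "J \<subseteq> {..<M}" "a < (\<Sum>j\<in>J. n j)"
  shows "stack J x $ a = stack {..<M} x $ (nbr_pos n J ! a)"
proof -
  have "stack {..<M} x \<in> carrier_vec (\<Sum>k<M. n k)"
    using assms(1) by (intro stack_carrier) auto
  from sel_W_mult_vec_index[OF assms(2,3) this] show ?thesis
    using sel_W_stack[OF assms(1,2)] by simp
qed

text \<open>The quantifier over \<open>x\<close> stands inside the obtained fact so that one pair
  \<open>j\<close>, \<open>b\<close> serves several families at once, such as the summands and the
  sum in \<open>stack_add\<close>, or the scalings and the states in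
  \<open>nbr_alpha_sqrt_stack\<close>.\<close>

lemma nbr_pos_cases:
  assumes "J \<subseteq> {..<M}" "a < (\<Sum>j\<in>J. n j)"
  obtains j b where "j \<in> J" "b < n j" "\<forall>x. (\<forall>j<M. x j \<in> carrier_vec (n j)) \<longrightarrow> stack J x $ a = x j $ b"
proof -
  have fin: "finite J" using assms(1) finite_subset by blast
  then have "nbr_pos n J ! a \<in> set (nbr_pos n J)"
    using assms(2) by (simp add: length_nbr_pos)
  then obtain j b where jb: "j \<in> J" "b < n j" "nbr_pos n J ! a = (\<Sum>k<j. n k) + b"
    by (auto simp: set_nbr_pos[OF fin])
  have "stack J x $ a = x j $ b" if "\<forall>j<M. x j \<in> carrier_vec (n j)" for x
    using stack_nbr_pos[of M x n J a] stack_index[of M x n j b] that assms jb by auto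
  with jb show thesis by (intro that) auto
qed

lemma stack_add:
  assumes "\<And>j. j < M \<Longrightarrow> x j \<in> carrier_vec (n j)" "\<And>j. j < M \<Longrightarrow> y j \<in> carrier_vec (n j)"
    and "J \<subseteq> {..<M}"
  shows "stack J (\<lambda>j. x j + y j) = stack J x + stack J y"
proof -
  have fin: "finite J" using assms(3) finite_subset by blast
  have c: "stack J x \<in> carrier_vec (\<Sum>j\<in>J. n j)" "stack J y \<in> carrier_vec (\<Sum>j\<in>J. n j)"
    "stack J (\<lambda>j. x j + y j) \<in> carrier_vec (\<Sum>j\<in>J. n j)"
    using assms by (auto intro!: stack_carrier[OF fin])
  show ?thesis
  proof (rule eq_vecI)
    fix a assume "a < dim_vec (stack J x + stack J y)"
    then have a: "a < (\<Sum>j\<in>J. n j)" using c by simp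
    obtain j b where jb: "j \<in> J" "b < n j"
      and st: "\<forall>x. (\<forall>j<M. x j \<in> carrier_vec (n j)) \<longrightarrow> stack J x $ a = x j $ b"
      by (rule nbr_pos_cases[OF assms(3) a])
    have "j < M" using jb(1) assms(3) by auto
    then have "x j \<in> carrier_vec (n j)" "y j \<in> carrier_vec (n j)"
      using assms(1,2) by auto
    then show "stack J (\<lambda>j. x j + y j) $ a = (stack J x + stack J y) $ a"
      using a c jb(2) assms(1,2) by (simp add: st)
  qed (use c in simp)
qed

text \<open>The transpose of W embeds the neighbor state into the global state with zeros elsewhere,
  and \<open>sel_U\<close> then reads component \<open>j\<close>, which was embedded because
  \<open>j\<close> is a neighbor.\<close>

lemma sel_U_transpose_sel_W_stack:
  assumes x: "\<And>j. j < M \<Longrightarrow> x j \<in> carrier_vec (n j)" and J: "J \<subseteq> {..<M}" and j: "j \<in> J"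
  shows "sel_U M n j *\<^sub>v ((sel_W M n J)\<^sup>T *\<^sub>v stack J x) = x j"
proof (rule eq_vecI)
  let ?W = "sel_W M n J" and ?N = "\<Sum>k<M. n k" and ?nJ = "\<Sum>j\<in>J. n j"
  have fin: "finite J" using J finite_subset by blast
  have jM: "j < M" using j J by auto
  have W: "?W \<in> carrier_mat ?nJ ?N" using J by (rule sel_W_carrier)
  have s: "stack J x \<in> carrier_vec ?nJ" using x J by (intro stack_carrier fin) auto
  fix b assume "b < dim_vec (x j)"
  then have b: "b < n j" using carrier_vecD[OF x[OF jM]] by simp
  let ?p = "(\<Sum>k<j. n k) + b"
  have p: "?p < ?N" using jM b by (rule offset_less)
  have "?p \<in> set (nbr_pos n J)" using fin j b by (auto simp: set_nbr_pos)
  then obtain a where a: "a < ?nJ" "nbr_pos n J ! a = ?p"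
    using fin by (auto simp: in_set_conv_nth length_nbr_pos)
  \<comment> \<open>Since \<open>nbr_pos\<close> has no repetitions, this column of W has its only 1
    in row \<open>a\<close>, so the sum over the column collapses to one term.\<close>
  have Wp: "?W $$ (a', ?p) = (if a' = a then 1 else 0)" if "a' < ?nJ" for a'
  proof -
    have "?W $$ (a', ?p) = row ?W a' $ ?p" using that p W by simp
    also have "\<dots> = (if nbr_pos n J ! a' = ?p then 1 else 0)"
      using that p J by (simp add: row_sel_W unit_vec_def)
    finally show ?thesis
      using that a fin nth_eq_iff_index_eq[OF distinct_nbr_pos, of a' n J a]
      by (simp add: length_nbr_pos)
  qed
  have "row (sel_U M n j) b = unit_vec ?N ?p"
    using arg_cong[OF rows_sel_U[OF jM, of n], of "\<lambda>xs. xs ! b"] b nth_rows[of b "sel_U M n j"]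
    by (simp add: sel_U_def)
  moreover have "?W\<^sup>T *\<^sub>v stack J x \<in> carrier_vec ?N"
    using W s by auto
  ultimately have "(sel_U M n j *\<^sub>v (?W\<^sup>T *\<^sub>v stack J x)) $ b = (?W\<^sup>T *\<^sub>v stack J x) $ ?p"
    using b p carrier_matD(1)[OF sel_U_carrier]
    by (simp only: index_mult_mat_vec scalar_prod_left_unit)
  also have "\<dots> = (\<Sum>a'<?nJ. ?W $$ (a', ?p) * stack J x $ a')"
    using p W s by (auto simp: scalar_prod_def atLeast0LessThan intro!: sum.cong)
  also have "\<dots> = (\<Sum>a'<?nJ. if a' = a then stack J x $ a' else 0)"
    by (intro sum.cong) (auto simp: Wp)
  also have "\<dots> = stack J x $ a" using a(1) by simp
  also have "\<dots> = x j $ b"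
    using stack_nbr_pos[OF x J a(1)] stack_index[of M x n j b] x jM b a(2) by simp
  finally show "(sel_U M n j *\<^sub>v (?W\<^sup>T *\<^sub>v stack J x)) $ b = x j $ b" .
qed (use carrier_vecD[OF x] j J in \<open>auto simp: sel_U_def\<close>)

section \<open>The diagonal scaling matrix and its root\<close>

lemma diag_block_mat_scalar_blocks:
  "diag_block_mat (map (\<lambda>j. \<alpha> j \<cdot>\<^sub>m 1\<^sub>m (n j)) js) =
     mat (\<Sum>j\<leftarrow>js. n j) (\<Sum>j\<leftarrow>js. n j)
       (\<lambda>(p, q). if p = q then concat (map (\<lambda>j. replicate (n j) (\<alpha> j)) js) ! p else (0 :: real))"
proof (induction js)
  case Nil
  show ?case by (intro eq_matI) auto
next
  case (Cons j js)
  show ?case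
    by (intro eq_matI) (auto simp: Cons.IH Let_def nth_append)
qed

text \<open>The diagonal of the global scaling matrix is itself a stacked vector, made of constant
  vectors, so \<open>stack_nbr_pos\<close> applies to it. Multiplying by W and its transpose reads
  the entry at two positions of \<open>nbr_pos\<close>; these differ off the diagonal, where the
  entry is 0 and stays 0 under \<open>sqrt\<close>.\<close>

lemma nbr_alpha_sqrt_index:
  assumes J: "J \<subseteq> {..<M}" and a: "a < (\<Sum>j\<in>J. n j)" and b: "b < (\<Sum>j\<in>J. n j)"
  shows "nbr_alpha_sqrt M n J \<alpha> $$ (a, b) =
    (if a = b then sqrt (stack J (\<lambda>j. vec (n j) (\<lambda>_. \<alpha> j)) $ a) else 0)"
proof -
  let ?W = "sel_W M n J" and ?N = "\<Sum>k<M. n k" and ?v = "\<lambda>j. vec (n j) (\<lambda>_. \<alpha> j)"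
  let ?D = "diag_block_mat (map (\<lambda>j. \<alpha> j \<cdot>\<^sub>m 1\<^sub>m (n j)) [0..<M])"
  have fin: "finite J" using J finite_subset by blast
  have W: "?W \<in> carrier_mat (\<Sum>j\<in>J. n j) ?N" using J by (rule sel_W_carrier)
  have s: "sorted_list_of_set {..<M} = [0..<M]"
    by (simp flip: atLeast0LessThan)
  have L: "(\<Sum>j\<leftarrow>[0..<M]. n j) = ?N"
    by (simp add: sum_list_distinct_conv_sum_set atLeast0LessThan)
  have "list_of_vec (?v j) = replicate (n j) (\<alpha> j)" for j
    by (rule nth_equalityI) (auto simp: list_of_vec_index)
  then have st: "stack {..<M} ?v = vec_of_list (concat (map (\<lambda>j. replicate (n j) (\<alpha> j)) [0..<M]))"
    by (simp add: stack_def s)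
  have D: "?D = mat ?N ?N (\<lambda>(p, q). if p = q then stack {..<M} ?v $ p else 0)"
    unfolding diag_block_mat_scalar_blocks L st vec_of_list_index ..
  let ?p = "\<lambda>a. nbr_pos n J ! a"
  have p: "?p a < ?N" "?p b < ?N" using J a b by (auto intro: nbr_pos_less)
  have Dc: "?D \<in> carrier_mat ?N ?N" unfolding D by simp
  have "nbr_alpha M n J \<alpha> $$ (a, b) = row (?W * ?D) a \<bullet> row ?W b"
    unfolding nbr_alpha_def using W Dc a b by (subst index_mult_mat(1)) auto
  also have "\<dots> = row (?W * ?D) a $ ?p b"
    unfolding row_sel_W[OF J b] using p W Dc
    by (intro scalar_prod_right_unit) (auto simp: carrier_vec_def)
  also have "\<dots> = row ?W a \<bullet> col ?D (?p b)"
    using p W Dc a b by simp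
  also have "\<dots> = ?D $$ (?p a, ?p b)"
    using p Dc a J by (simp add: row_sel_W)
  also have "\<dots> = (if ?p a = ?p b then stack {..<M} ?v $ ?p a else 0)"
    unfolding D using p by simp
  also have "?p a = ?p b \<longleftrightarrow> a = b"
    using a b fin by (intro nth_eq_iff_index_eq[OF distinct_nbr_pos]) (auto simp: length_nbr_pos)
  also have "stack {..<M} ?v $ ?p a = stack J ?v $ a"
    using J a by (intro stack_nbr_pos[symmetric]) auto
  finally show ?thesis
    unfolding nbr_alpha_sqrt_def using W a b by (simp add: nbr_alpha_def)
qed

lemma nbr_alpha_sqrt_carrier:
  assumes "J \<subseteq> {..<M}"
  shows "nbr_alpha_sqrt M n J \<alpha> \<in> carrier_mat (\<Sum>j\<in>J. n j) (\<Sum>j\<in>J. n j)"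
  using sel_W_carrier[OF assms, of n] by (auto simp: nbr_alpha_sqrt_def nbr_alpha_def)

lemma nbr_alpha_sqrt_transpose:
  assumes "J \<subseteq> {..<M}"
  shows "(nbr_alpha_sqrt M n J \<alpha>)\<^sup>T = nbr_alpha_sqrt M n J \<alpha>"
  using nbr_alpha_sqrt_carrier[OF assms, of n \<alpha>]
  by (intro eq_matI) (auto simp: nbr_alpha_sqrt_index[OF assms])

lemma nbr_alpha_sqrt_stack:
  assumes x: "\<And>j. j < M \<Longrightarrow> x j \<in> carrier_vec (n j)" and J: "J \<subseteq> {..<M}"
  shows "nbr_alpha_sqrt M n J \<alpha> *\<^sub>v stack J x = stack J (\<lambda>j. sqrt (\<alpha> j) \<cdot>\<^sub>v x j)"
proof -
  let ?nJ = "\<Sum>j\<in>J. n j" and ?A = "nbr_alpha_sqrt M n J \<alpha>"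
  have fin: "finite J" using J finite_subset by blast
  have A: "?A \<in> carrier_mat ?nJ ?nJ" using J by (rule nbr_alpha_sqrt_carrier)
  have s: "stack J x \<in> carrier_vec ?nJ" "stack J (\<lambda>j. sqrt (\<alpha> j) \<cdot>\<^sub>v x j) \<in> carrier_vec ?nJ"
    using x J by (auto intro!: stack_carrier[OF fin])
  show ?thesis
  proof (rule eq_vecI)
    fix a assume "a < dim_vec (stack J (\<lambda>j. sqrt (\<alpha> j) \<cdot>\<^sub>v x j))"
    then have a: "a < ?nJ" using s by simp
    obtain j b where jb: "j \<in> J" "b < n j"
      and st: "\<forall>x. (\<forall>j<M. x j \<in> carrier_vec (n j)) \<longrightarrow> stack J x $ a = x j $ b"
      by (rule nbr_pos_cases[OF J a])
    have "j < M" using jb(1) J by auto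
    then have xj: "x j \<in> carrier_vec (n j)" using x by simp
    have "(?A *\<^sub>v stack J x) $ a = (\<Sum>b<?nJ. ?A $$ (a, b) * stack J x $ b)"
      using a A s by (auto simp: scalar_prod_def atLeast0LessThan intro!: sum.cong)
    also have "\<dots> = (\<Sum>b<?nJ. if b = a then
        sqrt (stack J (\<lambda>j. vec (n j) (\<lambda>_. \<alpha> j)) $ a) * stack J x $ a else 0)"
      using a by (intro sum.cong) (auto simp: nbr_alpha_sqrt_index[OF J])
    also have "\<dots> = stack J (\<lambda>j. sqrt (\<alpha> j) \<cdot>\<^sub>v x j) $ a"
      using a jb(2) xj x by (simp add: st)
    finally show "(?A *\<^sub>v stack J x) $ a = stack J (\<lambda>j. sqrt (\<alpha> j) \<cdot>\<^sub>v x j) $ a" .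
  qed (use s A in simp)
qed

section \<open>Quadratic forms of the embedded ellipsoid matrices\<close>

lemma nbr_P_carrier:
  assumes "J \<subseteq> {..<M}"
  shows "nbr_P M n J P j \<in> carrier_mat (\<Sum>j\<in>J. n j) (\<Sum>j\<in>J. n j)"
  using sel_W_carrier[OF assms, of n] by (auto simp: nbr_P_def)

text \<open>The factors are applied one after another from the right until
  \<open>sel_U_transpose_sel_W_stack\<close> produces \<open>x j\<close>. The remaining W and
  \<open>?U\<^sup>T\<close> move to the other side of the scalar product as their transposes, where
  the same lemma produces \<open>x j\<close> again.\<close>

lemma nbr_P_quadratic_form:
  assumes x: "\<And>j. j < M \<Longrightarrow> x j \<in> carrier_vec (n j)" and J: "J \<subseteq> {..<M}" and j: "j \<in> J"
    and P: "P j \<in> carrier_mat (n j) (n j)"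
  shows "stack J x \<bullet> (nbr_P M n J P j *\<^sub>v stack J x) = x j \<bullet> (P j *\<^sub>v x j)"
proof -
  let ?W = "sel_W M n J" and ?U = "sel_U M n j" and ?N = "\<Sum>k<M. n k" and ?nJ = "\<Sum>j\<in>J. n j"
  let ?s = "stack J x"
  have fin: "finite J" using J finite_subset by blast
  have W: "?W \<in> carrier_mat ?nJ ?N" using J by (rule sel_W_carrier)
  have U: "?U \<in> carrier_mat (n j) ?N" by simp
  have s: "?s \<in> carrier_vec ?nJ" using x J by (auto intro!: stack_carrier[OF fin])
  have xj: "x j \<in> carrier_vec (n j)" using x j J by auto
  have UW: "?U *\<^sub>v (?W\<^sup>T *\<^sub>v ?s) = x j" using x J j by (rule sel_U_transpose_sel_W_stack)
  have c: "?W\<^sup>T \<in> carrier_mat ?N ?nJ" "?U\<^sup>T \<in> carrier_mat ?N (n j)" using W by auto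
  have v: "P j *\<^sub>v x j \<in> carrier_vec (n j)" using P xj by auto
  have "nbr_P M n J P j *\<^sub>v ?s = (?W * ?U\<^sup>T * P j * ?U) *\<^sub>v (?W\<^sup>T *\<^sub>v ?s)"
    unfolding nbr_P_def using W U P c s
    by (intro assoc_mult_mat_vec) (auto intro!: mult_carrier_mat)
  also have "\<dots> = (?W * ?U\<^sup>T * P j) *\<^sub>v x j"
    unfolding UW[symmetric] using W U P c s
    by (intro assoc_mult_mat_vec) (auto intro!: mult_carrier_mat mult_mat_vec_carrier)
  also have "\<dots> = (?W * ?U\<^sup>T) *\<^sub>v (P j *\<^sub>v x j)"
    using W U P c xj by (intro assoc_mult_mat_vec) (auto intro!: mult_carrier_mat)
  also have "\<dots> = ?W *\<^sub>v (?U\<^sup>T *\<^sub>v (P j *\<^sub>v x j))"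
    by (rule assoc_mult_mat_vec[OF W c(2) v])
  finally have "?s \<bullet> (nbr_P M n J P j *\<^sub>v ?s) = ?s \<bullet> (?W *\<^sub>v (?U\<^sup>T *\<^sub>v (P j *\<^sub>v x j)))"
    by simp
  also have "\<dots> = (?W\<^sup>T *\<^sub>v ?s) \<bullet> (?U\<^sup>T *\<^sub>v (P j *\<^sub>v x j))"
    by (rule transpose_vec_mult_scalar[OF W mult_mat_vec_carrier[OF c(2) v] s, symmetric])
  also have "\<dots> = (?U *\<^sub>v (?W\<^sup>T *\<^sub>v ?s)) \<bullet> (P j *\<^sub>v x j)"
    using transpose_vec_mult_scalar[OF c(2) v, of "?W\<^sup>T *\<^sub>v ?s"] c s by auto
  finally show ?thesis by (simp add: UW)
qed

text \<open>Because \<open>nbr_P_sum\<close> is defined entrywise, the form is expanded into a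
  double sum over entries, the sum over neighbors is moved outside, and each inner double sum is
  folded back into a quadratic form.\<close>

lemma nbr_P_sum_quadratic_form:
  assumes x: "\<And>j. j < M \<Longrightarrow> x j \<in> carrier_vec (n j)" and J: "J \<subseteq> {..<M}"
    and P: "\<And>j. j \<in> J \<Longrightarrow> P j \<in> carrier_mat (n j) (n j)"
  shows "stack J x \<bullet> (nbr_P_sum M n J P \<rho> *\<^sub>v stack J x) = (\<Sum>j\<in>J. \<rho> j * (x j \<bullet> (P j *\<^sub>v x j)))"
proof -
  let ?nJ = "\<Sum>j\<in>J. n j" and ?s = "stack J x"
  have fin: "finite J" using J finite_subset by blast
  have s: "?s \<in> carrier_vec ?nJ" using x J by (auto intro!: stack_carrier[OF fin])
  have q: "?s \<bullet> (A *\<^sub>v ?s) = (\<Sum>a<?nJ. \<Sum>b<?nJ. ?s $ a * (A $$ (a, b) * ?s $ b))"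
    if "A \<in> carrier_mat ?nJ ?nJ" for A
    using that s
    by (auto simp: scalar_prod_def atLeast0LessThan sum_distrib_left intro!: sum.cong)
  note Pc = nbr_P_carrier[OF J, of n P]
  have "?s \<bullet> (nbr_P_sum M n J P \<rho> *\<^sub>v ?s) =
      (\<Sum>a<?nJ. \<Sum>b<?nJ. \<Sum>j\<in>J. \<rho> j * (?s $ a * (nbr_P M n J P j $$ (a, b) * ?s $ b)))"
    using Pc by (subst q)
      (auto simp: nbr_P_sum_def sum_distrib_left sum_distrib_right algebra_simps carrier_matD[OF Pc] intro!: sum.cong)
  also have "\<dots> = (\<Sum>a<?nJ. \<Sum>j\<in>J. \<Sum>b<?nJ. \<rho> j * (?s $ a * (nbr_P M n J P j $$ (a, b) * ?s $ b)))"
    by (intro sum.cong refl sum.swap)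
  also have "\<dots> = (\<Sum>j\<in>J. \<Sum>a<?nJ. \<Sum>b<?nJ. \<rho> j * (?s $ a * (nbr_P M n J P j $$ (a, b) * ?s $ b)))"
    by (rule sum.swap)
  also have "\<dots> = (\<Sum>j\<in>J. \<rho> j * (?s \<bullet> (nbr_P M n J P j *\<^sub>v ?s)))"
    by (simp add: q[OF Pc] sum_distrib_left)
  also have "\<dots> = (\<Sum>j\<in>J. \<rho> j * (x j \<bullet> (P j *\<^sub>v x j)))"
    using x J P by (intro sum.cong) (auto simp: nbr_P_quadratic_form)
  finally show ?thesis .
qed

section \<open>Products and quadratic forms of three-by-three block matrices\<close>

text \<open>\<open>block3_mat\<close> nests two-by-two block matrices, padded with blocks of zero
  width or height. The two-by-two rule is applied at each level; the empty vectors that pair with or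
  result from the padding are removed by \<open>e\<close> and \<open>e'\<close>.\<close>

lemma block3_mat_mult_vec:
  assumes "A11 \<in> carrier_mat p p" "A12 \<in> carrier_mat p q" "A13 \<in> carrier_mat p r"
    and "A21 \<in> carrier_mat q p" "A22 \<in> carrier_mat q q" "A23 \<in> carrier_mat q r"
    and "A31 \<in> carrier_mat r p" "A32 \<in> carrier_mat r q" "A33 \<in> carrier_mat r r"
    and a: "a \<in> carrier_vec p" and b: "b \<in> carrier_vec q" and d: "d \<in> carrier_vec r"
  shows "block3_mat A11 A12 A13 A21 A22 A23 A31 A32 A33 *\<^sub>v ((a @\<^sub>v b) @\<^sub>v d) =
    ((A11 *\<^sub>v a + A12 *\<^sub>v b + A13 *\<^sub>v d) @\<^sub>v (A21 *\<^sub>v a + A22 *\<^sub>v b + A23 *\<^sub>v d)) @\<^sub>v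
    (A31 *\<^sub>v a + A32 *\<^sub>v b + A33 *\<^sub>v d)"
proof -
  let ?B = "four_block_mat A13 (0\<^sub>m (dim_row A13) 0) A23 (0\<^sub>m (dim_row A23) 0)"
  let ?C = "four_block_mat A31 A32 (0\<^sub>m 0 (dim_col A31)) (0\<^sub>m 0 (dim_col A32))"
  have e: "w @\<^sub>v 0\<^sub>v 0 = w" for w :: "real vec"
    by (intro eq_vecI) auto
  have e': "w @\<^sub>v v = w" if "dim_vec v = 0" for v w :: "real vec"
    using that by (intro eq_vecI) auto
  have B: "?B \<in> carrier_mat (p + q) r" "?C \<in> carrier_mat r (p + q)"
    using assms by auto
  have "?B *\<^sub>v (d @\<^sub>v 0\<^sub>v 0) = (A13 *\<^sub>v d + 0\<^sub>m (dim_row A13) 0 *\<^sub>v 0\<^sub>v 0) @\<^sub>v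
      (A23 *\<^sub>v d + 0\<^sub>m (dim_row A23) 0 *\<^sub>v 0\<^sub>v 0)"
    using assms by (intro four_block_mat_mult_vec) auto
  also have "A13 *\<^sub>v d + 0\<^sub>m (dim_row A13) 0 *\<^sub>v 0\<^sub>v 0 = A13 *\<^sub>v d"
    by (intro eq_vecI) (auto simp: scalar_prod_def)
  also have "A23 *\<^sub>v d + 0\<^sub>m (dim_row A23) 0 *\<^sub>v 0\<^sub>v 0 = A23 *\<^sub>v d"
    by (intro eq_vecI) (auto simp: scalar_prod_def)
  finally have Bd: "?B *\<^sub>v d = (A13 *\<^sub>v d) @\<^sub>v (A23 *\<^sub>v d)"
    by (simp only: e)
  have "?C *\<^sub>v (a @\<^sub>v b) = (A31 *\<^sub>v a + A32 *\<^sub>v b) @\<^sub>v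
      (0\<^sub>m 0 (dim_col A31) *\<^sub>v a + 0\<^sub>m 0 (dim_col A32) *\<^sub>v b)"
    using assms by (intro four_block_mat_mult_vec) auto
  then have Cab: "?C *\<^sub>v (a @\<^sub>v b) = A31 *\<^sub>v a + A32 *\<^sub>v b"
    by (simp add: e')
  have Aab: "four_block_mat A11 A12 A21 A22 *\<^sub>v (a @\<^sub>v b) =
      (A11 *\<^sub>v a + A12 *\<^sub>v b) @\<^sub>v (A21 *\<^sub>v a + A22 *\<^sub>v b)"
    using assms by (intro four_block_mat_mult_vec) auto
  have "block3_mat A11 A12 A13 A21 A22 A23 A31 A32 A33 *\<^sub>v ((a @\<^sub>v b) @\<^sub>v d) =
      (four_block_mat A11 A12 A21 A22 *\<^sub>v (a @\<^sub>v b) + ?B *\<^sub>v d) @\<^sub>v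
      (?C *\<^sub>v (a @\<^sub>v b) + A33 *\<^sub>v d)"
    unfolding block3_mat_def using assms B by (intro four_block_mat_mult_vec) auto
  also have "four_block_mat A11 A12 A21 A22 *\<^sub>v (a @\<^sub>v b) + ?B *\<^sub>v d =
      (A11 *\<^sub>v a + A12 *\<^sub>v b + A13 *\<^sub>v d) @\<^sub>v (A21 *\<^sub>v a + A22 *\<^sub>v b + A23 *\<^sub>v d)"
    unfolding Aab Bd using assms by (intro append_vec_add[of _ p _ _ q]) auto
  finally show ?thesis by (simp add: Cab)
qed

lemma block3_mat_quadratic_form:
  assumes A: "A11 \<in> carrier_mat p p" "A12 \<in> carrier_mat p q" "A13 \<in> carrier_mat p r"
      "A22 \<in> carrier_mat q q" "A33 \<in> carrier_mat r r"
    and v: "a \<in> carrier_vec p" "b \<in> carrier_vec q" "d \<in> carrier_vec r"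
  shows "((a @\<^sub>v b) @\<^sub>v d) \<bullet>
      (block3_mat A11 A12 A13 A12\<^sup>T A22 (0\<^sub>m q r) A13\<^sup>T (0\<^sub>m r q) A33 *\<^sub>v ((a @\<^sub>v b) @\<^sub>v d)) =
    a \<bullet> (A11 *\<^sub>v a) + 2 * (a \<bullet> (A12 *\<^sub>v b)) + 2 * (a \<bullet> (A13 *\<^sub>v d)) +
    b \<bullet> (A22 *\<^sub>v b) + d \<bullet> (A33 *\<^sub>v d)"
proof -
  \<comment> \<open>Each block below the diagonal contributes the same scalar as its mirror image,
    which is the source of the factors 2.\<close>
  have t: "b \<bullet> (A12\<^sup>T *\<^sub>v a) = a \<bullet> (A12 *\<^sub>v b)" "d \<bullet> (A13\<^sup>T *\<^sub>v a) = a \<bullet> (A13 *\<^sub>v d)"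
    using A v transpose_vec_mult_scalar[of A12 p q b a] transpose_vec_mult_scalar[of A13 p r d a]
    by (auto simp: comm_scalar_prod[of _ q] comm_scalar_prod[of _ r])
  have z: "0\<^sub>m q r *\<^sub>v d = 0\<^sub>v q" "0\<^sub>m r q *\<^sub>v b = 0\<^sub>v r"
    using v by auto
  note c = A v mult_mat_vec_carrier[OF A(1) v(1)] mult_mat_vec_carrier[OF A(2) v(2)]
    mult_mat_vec_carrier[OF A(3) v(3)] mult_mat_vec_carrier[OF A(4) v(2)]
    mult_mat_vec_carrier[OF A(5) v(3)]
  have c': "A12\<^sup>T *\<^sub>v a \<in> carrier_vec q" "A13\<^sup>T *\<^sub>v a \<in> carrier_vec r" using c by auto
  have "((a @\<^sub>v b) @\<^sub>v d) \<bullet>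
      (block3_mat A11 A12 A13 A12\<^sup>T A22 (0\<^sub>m q r) A13\<^sup>T (0\<^sub>m r q) A33 *\<^sub>v ((a @\<^sub>v b) @\<^sub>v d)) =
    ((a @\<^sub>v b) @\<^sub>v d) \<bullet> (((A11 *\<^sub>v a + A12 *\<^sub>v b + A13 *\<^sub>v d) @\<^sub>v
      (A12\<^sup>T *\<^sub>v a + A22 *\<^sub>v b + 0\<^sub>m q r *\<^sub>v d)) @\<^sub>v (A13\<^sup>T *\<^sub>v a + 0\<^sub>m r q *\<^sub>v b + A33 *\<^sub>v d))"
    using A v by (subst block3_mat_mult_vec[where p = p and q = q and r = r]) auto
  also have "\<dots> = a \<bullet> (A11 *\<^sub>v a + A12 *\<^sub>v b + A13 *\<^sub>v d) +
      b \<bullet> (A12\<^sup>T *\<^sub>v a + A22 *\<^sub>v b) + d \<bullet> (A13\<^sup>T *\<^sub>v a + A33 *\<^sub>v d)"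
    using c c' by (simp add: z scalar_prod_append[of _ "p + q" _ r] scalar_prod_append[of _ p _ q])
  also have "\<dots> = a \<bullet> (A11 *\<^sub>v a) + a \<bullet> (A12 *\<^sub>v b) + a \<bullet> (A13 *\<^sub>v d) +
      (b \<bullet> (A12\<^sup>T *\<^sub>v a) + b \<bullet> (A22 *\<^sub>v b)) + (d \<bullet> (A13\<^sup>T *\<^sub>v a) + d \<bullet> (A33 *\<^sub>v d))"
    using c c' by (simp add: scalar_prod_add_distrib[of _ p] scalar_prod_add_distrib[of _ q]
        scalar_prod_add_distrib[of _ r])
  finally show ?thesis by (simp add: t)
qed

section \<open>The quadratic form of the matrix inequality at the test vector\<close>

text \<open>Real numbers enter block vectors as one-dimensional vectors
  \<open>vec 1 (\<lambda>_. t)\<close>. This lemma and the next two turn the products with the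
  corresponding blocks back into ordinary arithmetic.\<close>

lemma col_mat_mult_vec: "col_mat v *\<^sub>v vec 1 (\<lambda>_. t) = t \<cdot>\<^sub>v v"
  by (intro eq_vecI) (auto simp: col_mat_def scalar_prod_def mat_of_cols_def)

lemma vec1_scalar_mat_vec1: "vec 1 (\<lambda>_. t) \<bullet> (scalar_mat a *\<^sub>v vec 1 (\<lambda>_. t)) = a * t\<^sup>2"
  by (simp add: scalar_mat_def scalar_prod_def power2_eq_square)

lemma vec1_mat_of_row_mult: "vec 1 (\<lambda>_. t) \<bullet> (mat_of_row g *\<^sub>v w) = t * (g \<bullet> w)"
  by (simp add: scalar_prod_def)

text \<open>This is an exact identity for arbitrary \<open>s\<close>; the ellipsoid bounds enter
  only in the theorem. The two corner blocks give \<open>hl\<close> twice minus the sum of the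
  multipliers, and the middle block supplies the other part of each
  \<open>\<rho> j * (1 - s j \<bullet> (P j *\<^sub>v s j))\<close>.\<close>

lemma input_lmi_quadratic_form:
  assumes J: "J \<subseteq> {..<M}" and K: "K \<in> carrier_mat m (\<Sum>j\<in>J. n j)" and g: "g \<in> carrier_vec m"
    and P: "\<And>j. j \<in> J \<Longrightarrow> P j \<in> carrier_mat (n j) (n j)"
    and c: "\<And>j. j < M \<Longrightarrow> c j \<in> carrier_vec (n j)" and s: "\<And>j. j < M \<Longrightarrow> s j \<in> carrier_vec (n j)"
  defines "v \<equiv> (vec 1 (\<lambda>_. -1) @\<^sub>v stack J s) @\<^sub>v vec 1 (\<lambda>_. 1)"
  shows "v \<bullet> (input_lmi_mat M n J K P c \<alpha> (mat_of_row g) hl \<rho> *\<^sub>v v) =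
    2 * hl - 2 * (g \<bullet> (K *\<^sub>v stack J (\<lambda>j. sqrt (\<alpha> j) \<cdot>\<^sub>v s j + c j))) -
    (\<Sum>j\<in>J. \<rho> j * (1 - s j \<bullet> (P j *\<^sub>v s j)))"
proof -
  let ?nJ = "\<Sum>j\<in>J. n j"
  let ?A = "nbr_alpha_sqrt M n J \<alpha>" and ?G = "mat_of_row g" and ?c = "stack J c"
  let ?C = "col_mat ?c"
  have fin: "finite J" using J finite_subset by blast
  have cN: "nbr_center M n J c = ?c"
    unfolding nbr_center_def using c J by (rule sel_W_stack)
  have st: "?c \<in> carrier_vec ?nJ" "stack J s \<in> carrier_vec ?nJ"
    using c s J by (auto intro!: stack_carrier[OF fin])
  have G: "?G \<in> carrier_mat 1 m" using g by auto
  have A: "?A \<in> carrier_mat ?nJ ?nJ" using J by (rule nbr_alpha_sqrt_carrier)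
  have C: "?C \<in> carrier_mat ?nJ 1" using st mat_of_cols_carrier(1)[of ?nJ "[?c]"] by (simp add: col_mat_def)
  have GK: "?G * K \<in> carrier_mat 1 ?nJ" using G K by simp
  \<comment> \<open>The lower blocks of \<open>input_lmi_mat\<close> are written as products;
    \<open>t1\<close> and \<open>t2\<close> exhibit them as transposes of the upper ones, the form
    that \<open>block3_mat_quadratic_form\<close> expects.\<close>
  have t1: "?A * K\<^sup>T * ?G\<^sup>T = (?G * K * ?A)\<^sup>T"
  proof -
    have "(?G * K * ?A)\<^sup>T = ?A * (K\<^sup>T * ?G\<^sup>T)"
      by (simp add: transpose_mult[OF GK A] transpose_mult[OF G K] nbr_alpha_sqrt_transpose[OF J])
    also have "\<dots> = ?A * K\<^sup>T * ?G\<^sup>T"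
      using A K G by (intro assoc_mult_mat[symmetric]) auto
    finally show ?thesis by simp
  qed
  have t2: "?C\<^sup>T * K\<^sup>T * ?G\<^sup>T = (?G * K * ?C)\<^sup>T"
  proof -
    have "(?G * K * ?C)\<^sup>T = ?C\<^sup>T * (K\<^sup>T * ?G\<^sup>T)"
      by (simp add: transpose_mult[OF GK C] transpose_mult[OF G K])
    also have "\<dots> = ?C\<^sup>T * K\<^sup>T * ?G\<^sup>T"
      using C K G by (intro assoc_mult_mat[symmetric]) auto
    finally show ?thesis by simp
  qed
  \<comment> \<open>One rule for both off-diagonal blocks: \<open>B\<close> is the root of the
    scaling or the center column. The minus sign comes from the first entry of the test
    vector.\<close>
  have GKv: "vec 1 (\<lambda>_. -1) \<bullet> (?G * K * B *\<^sub>v w) = - (g \<bullet> (K *\<^sub>v (B *\<^sub>v w)))"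
    if "B \<in> carrier_mat ?nJ k" "w \<in> carrier_vec k" for B w k
  proof -
    have "?G * K * B *\<^sub>v w = (?G * K) *\<^sub>v (B *\<^sub>v w)"
      using GK that by (rule assoc_mult_mat_vec)
    also have "\<dots> = ?G *\<^sub>v (K *\<^sub>v (B *\<^sub>v w))"
      using G K that by (intro assoc_mult_mat_vec) auto
    finally show ?thesis by (simp only: vec1_mat_of_row_mult)
  qed
  have As: "?A *\<^sub>v stack J s = stack J (\<lambda>j. sqrt (\<alpha> j) \<cdot>\<^sub>v s j)"
    using s J by (rule nbr_alpha_sqrt_stack)
  have sum: "stack J (\<lambda>j. sqrt (\<alpha> j) \<cdot>\<^sub>v s j + c j) = ?A *\<^sub>v stack J s + ?c"
    unfolding As using s c J by (intro stack_add) auto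
  have "g \<bullet> (K *\<^sub>v stack J (\<lambda>j. sqrt (\<alpha> j) \<cdot>\<^sub>v s j + c j)) =
      g \<bullet> (K *\<^sub>v (?A *\<^sub>v stack J s) + K *\<^sub>v ?c)"
    unfolding sum using K A st by (subst mult_add_distrib_mat_vec) auto
  also have "\<dots> = g \<bullet> (K *\<^sub>v (?A *\<^sub>v stack J s)) + g \<bullet> (K *\<^sub>v ?c)"
    using g K A st by (intro scalar_prod_add_distrib) auto
  finally have lin: "g \<bullet> (K *\<^sub>v stack J (\<lambda>j. sqrt (\<alpha> j) \<cdot>\<^sub>v s j + c j)) =
      g \<bullet> (K *\<^sub>v (?A *\<^sub>v stack J s)) + g \<bullet> (K *\<^sub>v ?c)" .
  have S: "scalar_mat x \<in> carrier_mat 1 1" for x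
    by (simp add: scalar_mat_def)
  have Q: "nbr_P_sum M n J P \<rho> \<in> carrier_mat ?nJ ?nJ"
    by (simp add: nbr_P_sum_def)
  have mv: "vec 1 f \<in> carrier_vec 1" for f :: "nat \<Rightarrow> real"
    by simp
  note GKA = mult_carrier_mat[OF GK A] and GKC = mult_carrier_mat[OF GK C]
  have "v \<bullet> (input_lmi_mat M n J K P c \<alpha> ?G hl \<rho> *\<^sub>v v) =
      hl * (-1)\<^sup>2 + 2 * - (g \<bullet> (K *\<^sub>v (?A *\<^sub>v stack J s))) + 2 * - (g \<bullet> (K *\<^sub>v (1 \<cdot>\<^sub>v ?c))) +
      stack J s \<bullet> (nbr_P_sum M n J P \<rho> *\<^sub>v stack J s) + (hl - (\<Sum>j\<in>J. \<rho> j)) * 1\<^sup>2"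
    unfolding input_lmi_mat_def Let_def cN v_def t1 t2
    unfolding block3_mat_quadratic_form[OF S GKA GKC Q S mv st(2) mv]
      GKv[OF A st(2)] GKv[OF C mv] col_mat_mult_vec vec1_scalar_mat_vec1 ..
  then show ?thesis
    using nbr_P_sum_quadratic_form[of M s n J P \<rho>] s J P
    by (simp add: lin sum_subtractf right_diff_distrib)
qed

section \<open>The input constraint on the product of terminal ellipsoids\<close>

theorem proposition4:
  fixes M i l :: nat
    and n m r :: "nat \<Rightarrow> nat"
    and N :: "nat \<Rightarrow> nat set"
    and K P H :: "nat \<Rightarrow> real mat"
    and h c :: "nat \<Rightarrow> real vec"
    and \<alpha> :: "nat \<Rightarrow> real"
  assumes "\<And>j. j < M \<Longrightarrow> N j \<subseteq> {..<M}"
    and "\<And>j. j < M \<Longrightarrow> j \<in> N j"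
    and "\<And>j. j < M \<Longrightarrow> K j \<in> carrier_mat (m j) (\<Sum>k\<in>N j. n k)"
    and "\<And>j. j < M \<Longrightarrow> pos_def (n j) (P j)"
    and "\<And>j. j < M \<Longrightarrow> H j \<in> carrier_mat (r j) (m j)"
    and "\<And>j. j < M \<Longrightarrow> h j \<in> carrier_vec (r j)"
    and "\<And>j. j < M \<Longrightarrow> origin_in_interior (m j) (input_set (m j) (H j) (h j))"
    and "i < M" and "l < r i"
    and "\<And>j. j < M \<Longrightarrow> c j \<in> carrier_vec (n j)"
    and "\<And>j. j < M \<Longrightarrow> 0 \<le> \<alpha> j"
    and "\<exists>\<rho>. (\<forall>j\<in>N i. 0 \<le> \<rho> j) \<and>
           pos_semidef (1 + (\<Sum>j\<in>N i. n j) + 1)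
             (input_lmi_mat M n (N i) (K i) P c \<alpha> (mat_of_row (row (H i) l)) (h i $ l) \<rho>)"
  shows "\<forall>xN \<in> carrier_vec (\<Sum>j\<in>N i. n j). \<forall>x.
           xN = stack (N i) x \<and> (\<forall>j\<in>N i. x j \<in> terminal_set (n j) (P j) (c j) (\<alpha> j)) \<longrightarrow>
           row (H i) l \<bullet> (K i *\<^sub>v xN) \<le> h i $ l"
proof (intro ballI allI impI, elim conjE)
  fix xN x
  let ?J = "N i" and ?g = "row (H i) l"
  \<comment> \<open>Inverts the scaling \<open>x j = c j + sqrt (\<alpha> j) s j\<close> on the
    neighbors. Elsewhere \<open>x\<close> is arbitrary, even in dimension, while the lemmas on
    stacks ask for the right dimension for every \<open>j < M\<close>; hence the zero
    vectors.\<close>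
  let ?s = "\<lambda>j. if j \<in> ?J then (1 / sqrt (\<alpha> j)) \<cdot>\<^sub>v (x j - c j) else 0\<^sub>v (n j)"
  assume xN: "xN = stack ?J x" and T: "\<forall>j\<in>?J. x j \<in> terminal_set (n j) (P j) (c j) (\<alpha> j)"
  have J: "?J \<subseteq> {..<M}" using assms(1,8) by simp
  then have fin: "finite ?J" using finite_subset by blast
  have jM: "j < M" if "j \<in> ?J" for j using that J by auto
  have P: "P j \<in> carrier_mat (n j) (n j)" if "j \<in> ?J" for j
    using assms(4)[OF jM[OF that]] by (simp add: pos_def_def)
  have x: "x j \<in> carrier_vec (n j)" "(x j - c j) \<bullet> (P j *\<^sub>v (x j - c j)) \<le> \<alpha> j"
    if "j \<in> ?J" for j
    using T that by (auto simp: terminal_set_def)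
  have y: "x j - c j \<in> carrier_vec (n j)" if "j \<in> ?J" for j
    using x(1)[OF that] assms(10)[OF jM[OF that]] by simp
  have s: "?s j \<in> carrier_vec (n j)" if "j < M" for j
    using y by auto
  have scale: "sqrt (\<alpha> j) \<cdot>\<^sub>v ?s j = x j - c j" if j: "j \<in> ?J" for j
  proof (cases "\<alpha> j = 0")
    case True
    \<comment> \<open>The ellipsoid degenerates to its center, and \<open>1 / sqrt 0 = 0\<close>.\<close>
    then have "x j - c j = 0\<^sub>v (n j)"
      using assms(4)[OF jM[OF j]] x(2)[OF j] y[OF j] by (force simp: pos_def_def)
    then show ?thesis using j by (auto intro!: eq_vecI)
  next
    case False
    then show ?thesis
      using j by (simp add: smult_smult_assoc)
  qed
  have bound: "?s j \<bullet> (P j *\<^sub>v ?s j) \<le> 1" if j: "j \<in> ?J" for j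
  proof -
    have "?s j \<bullet> (P j *\<^sub>v ?s j) = (1 / sqrt (\<alpha> j))\<^sup>2 * ((x j - c j) \<bullet> (P j *\<^sub>v (x j - c j)))"
      using j y[OF j] P[OF j]
      by (simp add: mult_mat_vec[OF P[OF j] y[OF j]] power2_eq_square)
    also have "\<dots> \<le> (1 / sqrt (\<alpha> j))\<^sup>2 * \<alpha> j"
      using x(2)[OF j] by (intro mult_left_mono) auto
    \<comment> \<open>For positive \<open>\<alpha> j\<close> the product equals 1; for
      \<open>\<alpha> j = 0\<close> it is 0.\<close>
    also have "\<dots> \<le> 1"
      using assms(11)[OF jM[OF j]] by (simp add: power_divide)
    finally show ?thesis .
  qed
  \<comment> \<open>The two families may differ outside the neighbors, so they are compared by
    \<open>stack_cong\<close> on \<open>?J\<close> only.\<close>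
  have st: "stack ?J (\<lambda>j. sqrt (\<alpha> j) \<cdot>\<^sub>v ?s j + c j) = xN"
    unfolding xN
  proof (rule stack_cong[OF fin])
    fix j assume j: "j \<in> ?J"
    show "sqrt (\<alpha> j) \<cdot>\<^sub>v ?s j + c j = x j"
      unfolding scale[OF j] using x(1)[OF j] assms(10)[OF jM[OF j]] by (intro eq_vecI) auto
  qed
  obtain \<rho> where \<rho>: "\<forall>j\<in>?J. 0 \<le> \<rho> j"
    and psd: "pos_semidef (1 + (\<Sum>j\<in>?J. n j) + 1)
      (input_lmi_mat M n ?J (K i) P c \<alpha> (mat_of_row ?g) (h i $ l) \<rho>)"
    using assms(12) by blast
  \<comment> \<open>The entry -1 yields the upper bound on the input; with 1 in its place the same
    form would bound it from below by \<open>- h i $ l\<close>.\<close>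
  let ?v = "(vec 1 (\<lambda>_. -1) @\<^sub>v stack ?J ?s) @\<^sub>v vec 1 (\<lambda>_. 1 :: real)"
  have "stack ?J ?s \<in> carrier_vec (\<Sum>j\<in>?J. n j)"
    using s jM by (intro stack_carrier[OF fin]) blast
  then have "?v \<in> carrier_vec (1 + (\<Sum>j\<in>?J. n j) + 1)"
    by (intro append_carrier_vec) auto
  then have "0 \<le> ?v \<bullet> (input_lmi_mat M n ?J (K i) P c \<alpha> (mat_of_row ?g) (h i $ l) \<rho> *\<^sub>v ?v)"
    using psd unfolding pos_semidef_def by blast
  also have "\<dots> = 2 * h i $ l - 2 * (?g \<bullet> (K i *\<^sub>v xN)) -
      (\<Sum>j\<in>?J. \<rho> j * (1 - ?s j \<bullet> (P j *\<^sub>v ?s j)))"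
    unfolding st[symmetric]
    using J assms(3)[OF assms(8)] row_carrier_vec[OF assms(9) assms(5)[OF assms(8)]] P assms(10) s
    by (rule input_lmi_quadratic_form)
  finally have "(\<Sum>j\<in>?J. \<rho> j * (1 - ?s j \<bullet> (P j *\<^sub>v ?s j))) \<le>
      2 * h i $ l - 2 * (?g \<bullet> (K i *\<^sub>v xN))"
    by simp
  \<comment> \<open>The S-procedure: each nonnegative multiplier meets the nonnegative slack of its
    own ellipsoid constraint.\<close>
  moreover have "0 \<le> (\<Sum>j\<in>?J. \<rho> j * (1 - ?s j \<bullet> (P j *\<^sub>v ?s j)))"
    using \<rho> bound by (intro sum_nonneg mult_nonneg_nonneg) auto
  ultimately show "?g \<bullet> (K i *\<^sub>v xN) \<le> h i $ l" by linarith
qed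

end
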